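(* Let $N\ge 1$ and let $S=(S_{xy})_{x,y=1}^N$ be a nonzero symmetric $N\times N$ matrix with nonnegative entries. Let $\rho$ be the self-consistent density of states associated with $S$, i.e. the measure obtained from the unique solution of the quadratic vector equation of $S$ by inverse Stieltjes transform (see context). For $j\in\mathbb{N}$ set $$z_j:=\frac{\|S^j\|}{\|S\|^j}.$$ Then for any fixed $J\in\mathbb{N}\cup\{\infty\}$ we have $$\max\operatorname{supp}\rho\le 2\,\frac{\|S\|^{1/2}}{w_c(J)},$$ where $w_c(J)$ is the smallest positive root of the function $$\phi_J(w):=1-\frac{w}{2}\Big(1+\sum_{j=1}^J\Big(\frac{w}{2}\Big)^j z_j+\sum_{j>J}\Big(\frac{w}{2}\Big)^j\Big).$$
   Context: For a matrix $M$, $\|M\|:=\max_x\sum_y|M_{xy}|$ denotes the norm induced by the maximum norm on $\mathbb{C}^N$. For $J=\infty$ the last sum in $\phi_J$ is empty. Quadratic vector equation: for $z$ in the complex upper half plane $\mathbb{H}$ consider the system $$-\frac{1}{m_x}=z+\sum_{y=1}^N S_{xy}m_y,\qquad x=1,\dots,N.$$ Under the condition $\operatorname{Im} m_x>0$ for all $x$ it has a unique solution $(m_x(z))_{x=1}^N$, which is analytic in $z\in\mathbb{H}$. The average $m(z)=\frac1N\sum_{x=1}^N m_x(z)$ is the Stieltjes transform $m(z)=\int_{\mathbb{R}}\frac{\rho(d\tau)}{\tau-z}$ of a compactly supported probability measure $\rho$ on $\mathbb{R}$, which is the self-consistent density of states; equivalently $$\rho(d\tau)=\lim_{\eta\downarrow0}\frac{1}{\pi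 N}\sum_{x=1}^N\operatorname{Im} m_x(\tau+i\eta)\,d\tau$$ (as a weak limit of measures). *)

theory Defs
  imports "HOL-Probability.Probability"
begin

definition max_row_sum_norm :: "real^'n^'n \<Rightarrow> real" where
  "max_row_sum_norm M = Max (range (\<lambda>x. \<Sum>y\<in>UNIV. \<bar>M $ x $ y\<bar>))"

(* The power for the matrix product: the library's multiplication on vectors of vectors,
   and hence its (^), would be componentwise. *)
primrec matrix_power :: "real^'n^'n \<Rightarrow> nat \<Rightarrow> real^'n^'n" where
  "matrix_power M 0 = mat 1"
| "matrix_power M (Suc j) = M ** matrix_power M j"

definition qve_solution :: "real^'n^'n \<Rightarrow> (complex \<Rightarrow> complex^'n) \<Rightarrow> bool" where
  "qve_solution S m \<longleftrightarrow>
     (\<forall>z. Im z > 0 \<longrightarrow>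
        (\<forall>x. Im (m z $ x) > 0 \<and>
             - 1 / (m z $ x) = z + (\<Sum>y\<in>UNIV. of_real (S $ x $ y) * m z $ y)))"

definition msupp :: "real measure \<Rightarrow> real set" where
  "msupp \<rho> = {\<tau>. \<forall>U. open U \<and> \<tau> \<in> U \<longrightarrow> emeasure \<rho> U > 0}"

(* The solution m is unique on the upper half plane and a probability measure is determined by
   its Stieltjes transform, so at most one measure satisfies this predicate. *)
definition self_consistent_dos :: "real^'n^'n \<Rightarrow> real measure \<Rightarrow> bool" where
  "self_consistent_dos S \<rho> \<longleftrightarrow>
     prob_space \<rho> \<and> sets \<rho> = sets borel \<and> compact (msupp \<rho>) \<and>
     (\<exists>m. qve_solution S m \<and>
        (\<forall>z. Im z > 0 \<longrightarrow>
           (\<Sum>x\<in>UNIV. m z $ x) / of_nat CARD('n) = (LINT \<tau>|\<rho>. 1 / (of_real \<tau> - z))))"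

definition zcoeff :: "real^'n^'n \<Rightarrow> nat \<Rightarrow> real" where
  "zcoeff S j = max_row_sum_norm (matrix_power S j) / max_row_sum_norm S ^ j"

(* J :: enat, so that one formula covers J = \<infinity>, for which the last index set is empty. *)
definition phi :: "real^'n^'n \<Rightarrow> enat \<Rightarrow> real \<Rightarrow> real" where
  "phi S J w = 1 - (w / 2) *
     (1 + (\<Sum>\<^sub>\<infinity>j\<in>{j. 1 \<le> j \<and> enat j \<le> J}. (w / 2) ^ j * zcoeff S j)
        + (\<Sum>\<^sub>\<infinity>j\<in>{j. enat j > J}. (w / 2) ^ j))"

(* Divergent infinite sums have the value 0 in HOL, so convergence is required explicitly. *)
definition positive_root_phi :: "real^'n^'n \<Rightarrow> enat \<Rightarrow> real \<Rightarrow> bool" where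
  "positive_root_phi S J w \<longleftrightarrow> w > 0 \<and>
     (\<lambda>j. (w / 2) ^ j * zcoeff S j) summable_on {j. 1 \<le> j \<and> enat j \<le> J} \<and>
     (\<lambda>j. (w / 2) ^ j) summable_on {j. enat j > J} \<and>
     phi S J w = 0"

definition w_c :: "real^'n^'n \<Rightarrow> enat \<Rightarrow> real" where
  "w_c S J = (LEAST w. positive_root_phi S J w)"

end

theory Submission
  imports Defs
begin

text \<open>Let \<open>s = max_row_sum_norm S\<close>, let \<open>w\<close> be a positive root of \<^term>\<open>phi S J\<close>, and put
\<open>t = w / 2\<close> and \<open>b = sqrt s / t\<close>. The claim is that the support of the density of states lies in
\<open>[-b, b]\<close>. The function \<open>g = -m\<close> has the expansion \<open>g z = (\<Sum>n. M\<^sub>n / z ^ (2*n+1))\<close> at infinity,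
where \<open>M\<^sub>n\<close> (\<open>qve_moment\<close>) is a vector of weighted counts of Dyck paths of length \<open>2*n\<close>, and the
average of its components is the moment of order \<open>2*n\<close> of the measure. So it is enough to show that
\<open>M\<^sub>n\<close> grows at most like \<open>b ^ (2*n)\<close>.

The growth bound comes from the vector equation \<open>g = 1/z + g * (S g) / z\<close>, read as a linear equation for the
second factor \<open>g\<close> with the first one as a coefficient. Its Neumann series sorts the Dyck paths by
the length \<open>j\<close> of the up-run with which they begin. If \<open>g \<le> \<gamma>\<close> entrywise, the term of
index \<open>j\<close> is at most \<open>(\<gamma> / z) ^ j\<close> times the norm of the \<open>j\<close>-th power of \<open>S\<close>, divided by \<open>z\<close>. For
\<open>z = b\<close> and \<open>\<gamma> = 1 / sqrt s\<close> this is \<open>t ^ j * zcoeff S j / b\<close>, and the equation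
\<open>phi S J w = 0\<close> implies that the sum over \<open>j\<close> is at most \<open>1 / (t * b) = \<gamma>\<close>: the bound reproduces itself. Replacing
\<open>zcoeff S j \<le> 1\<close> by 1 for \<open>j > J\<close> only enlarges the sum, so all values of \<open>J\<close> are covered at once.
Carried out by induction for partial sums, this shows that the expansion converges at
\<open>z = b\<close> (\<open>qve_moment_partial_sum_le\<close>, \<open>summable_qve_moment\<close>).

To relate \<open>M\<^sub>n\<close> to the measure, only the points \<open>z = \<i> * \<eta>\<close> with \<open>\<eta> > b\<close> are needed. There the
series and the given solution are both so small that a contraction argument identifies them
(\<open>qve_solution_imaginary_axis\<close>). The imaginary part of the Stieltjes transform is then an
integral of \<open>1 / (1 + \<tau>\<^sup>2 / \<eta>\<^sup>2)\<close>, up to a factor, and a comparison of coefficients of powers of \<open>1 / \<eta>\<^sup>2\<close> gives the moments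
(\<open>msupp_dos_le\<close>).

The bounding function has exactly one positive root, because \<open>1 - phi S J w\<close> is a power series in
\<open>t\<close> with nonnegative coefficients that, for nonzero \<open>S\<close>, starts with \<open>t + t\<^sup>2\<close>
(\<open>positive_root_phi_exists\<close>, \<open>positive_root_phi_unique\<close>).\<close>

section \<open>The maximal row sum norm\<close>

lemma row_sum_le_max_row_sum_norm: "(\<Sum>y\<in>UNIV. \<bar>M $ x $ y\<bar>) \<le> max_row_sum_norm M"
  unfolding max_row_sum_norm_def by (rule Max_ge) auto

lemma max_row_sum_norm_le:
  assumes "\<And>x. (\<Sum>y\<in>UNIV. \<bar>M $ x $ y\<bar>) \<le> c"
  shows "max_row_sum_norm M \<le> c"
  unfolding max_row_sum_norm_def using assms by (subst Max_le_iff) auto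

lemma max_row_sum_norm_nonneg: "0 \<le> max_row_sum_norm M"
  by (rule order_trans[OF sum_nonneg row_sum_le_max_row_sum_norm[of M undefined]]) auto

lemma max_row_sum_norm_pos:
  assumes "M \<noteq> 0"
  shows "0 < max_row_sum_norm M"
proof -
  obtain x y where "M $ x $ y \<noteq> 0"
    using assms by (metis vec_eq_iff zero_index)
  hence "0 < \<bar>M $ x $ y\<bar>" by simp
  also have "\<dots> \<le> (\<Sum>y\<in>UNIV. \<bar>M $ x $ y\<bar>)"
    by (rule member_le_sum) auto
  finally show ?thesis
    using row_sum_le_max_row_sum_norm order_less_le_trans by blast
qed

lemma abs_matrix_vector_mult_le:
  assumes "\<And>y. \<bar>v $ y\<bar> \<le> c"
  shows "\<bar>(M *v v) $ x\<bar> \<le> max_row_sum_norm M * c"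
proof -
  have "0 \<le> c" using assms[of undefined] by linarith
  have "\<bar>(M *v v) $ x\<bar> \<le> (\<Sum>y\<in>UNIV. \<bar>M $ x $ y\<bar> * c)"
    unfolding matrix_vector_mult_def
    by (auto intro!: order_trans[OF sum_abs] sum_mono mult_left_mono assms simp: abs_mult)
  also have "\<dots> \<le> max_row_sum_norm M * c"
    unfolding sum_distrib_right[symmetric]
    by (intro mult_right_mono row_sum_le_max_row_sum_norm \<open>0 \<le> c\<close>)
  finally show ?thesis .
qed

lemma max_row_sum_norm_mult: "max_row_sum_norm (A ** B) \<le> max_row_sum_norm A * max_row_sum_norm B"
proof (rule max_row_sum_norm_le)
  fix x
  have "(\<Sum>y\<in>UNIV. \<bar>(A ** B) $ x $ y\<bar>) \<le> (\<Sum>y\<in>UNIV. \<Sum>k\<in>UNIV. \<bar>A $ x $ k\<bar> * \<bar>B $ k $ y\<bar>)"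
    unfolding matrix_matrix_mult_def
    by (auto intro!: sum_mono order_trans[OF sum_abs] simp: abs_mult)
  also have "\<dots> = (\<Sum>k\<in>UNIV. \<bar>A $ x $ k\<bar> * (\<Sum>y\<in>UNIV. \<bar>B $ k $ y\<bar>))"
    by (subst sum.swap) (simp add: sum_distrib_left)
  also have "\<dots> \<le> (\<Sum>k\<in>UNIV. \<bar>A $ x $ k\<bar> * max_row_sum_norm B)"
    by (intro sum_mono mult_left_mono row_sum_le_max_row_sum_norm) auto
  also have "\<dots> \<le> max_row_sum_norm A * max_row_sum_norm B"
    unfolding sum_distrib_right[symmetric]
    by (intro mult_right_mono row_sum_le_max_row_sum_norm max_row_sum_norm_nonneg)
  finally show "(\<Sum>y\<in>UNIV. \<bar>(A ** B) $ x $ y\<bar>) \<le> \<dots>" .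
qed

lemma max_row_sum_norm_mat_1: "max_row_sum_norm (mat 1 :: real^'n^'n) = 1"
proof -
  have "(\<Sum>y\<in>UNIV. \<bar>(mat 1 :: real^'n^'n) $ x $ y\<bar>) = 1" for x
    by (simp add: mat_def if_distrib[of abs] sum.delta cong: if_cong)
  thus ?thesis by (simp add: max_row_sum_norm_def)
qed

section \<open>The smallest positive root of the bounding function\<close>

lemma zcoeff_0: "zcoeff S 0 = 1"
  by (simp add: zcoeff_def max_row_sum_norm_mat_1)

lemma zcoeff_1: "S \<noteq> 0 \<Longrightarrow> zcoeff S 1 = 1"
  using max_row_sum_norm_pos[of S] by (simp add: zcoeff_def matrix_mul_rid)

lemma zcoeff_nonneg: "0 \<le> zcoeff S j"
  by (simp add: zcoeff_def max_row_sum_norm_nonneg)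

lemma zcoeff_le_1: "zcoeff S j \<le> 1"
proof -
  have "max_row_sum_norm (matrix_power S j) \<le> max_row_sum_norm S ^ j"
  proof (induction j)
    case (Suc j)
    have "max_row_sum_norm (matrix_power S (Suc j))
        \<le> max_row_sum_norm S * max_row_sum_norm (matrix_power S j)"
      by (simp add: max_row_sum_norm_mult)
    also have "\<dots> \<le> max_row_sum_norm S * max_row_sum_norm S ^ j"
      by (intro mult_left_mono Suc max_row_sum_norm_nonneg)
    finally show ?case by simp
  qed (simp add: max_row_sum_norm_mat_1)
  moreover have "0 \<le> max_row_sum_norm S ^ j"
    by (intro zero_le_power max_row_sum_norm_nonneg)
  ultimately show ?thesis
    unfolding zcoeff_def divide_le_eq_1 by linarith
qed

text \<open>The coefficients of the power series in \<^term>\<open>w / 2\<close> that defines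
\<^const>\<open>phi\<close>: beyond \<^term>\<open>J\<close> the exact value is replaced by the trivial
bound 1. With \<^term>\<open>zcoeff S 0 = 1\<close> the separate leading 1 of
\<^const>\<open>phi\<close> becomes the coefficient of index 0.\<close>

definition run_weight :: "real^'n^'n \<Rightarrow> enat \<Rightarrow> nat \<Rightarrow> real" where
  "run_weight S J j = (if enat j \<le> J then zcoeff S j else 1)"

lemma run_weight_nonneg: "0 \<le> run_weight S J j"
  by (simp add: run_weight_def zcoeff_nonneg)

lemma run_weight_le_1: "run_weight S J j \<le> 1"
  by (simp add: run_weight_def zcoeff_le_1)

lemma zcoeff_le_run_weight: "zcoeff S j \<le> run_weight S J j"
  by (simp add: run_weight_def zcoeff_le_1)

lemma run_weight_0: "run_weight S J 0 = 1"
  by (simp add: run_weight_def zcoeff_0)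

lemma run_weight_1: "S \<noteq> 0 \<Longrightarrow> run_weight S J 1 = 1"
  using zcoeff_1[of S] by (simp add: run_weight_def)

text \<open>All terms are nonnegative, so the two index sets and the isolated 1 can be merged into one ordinary
series without losing information about convergence.\<close>

lemma positive_root_phi_iff:
  "positive_root_phi S J w \<longleftrightarrow> w > 0 \<and> summable (\<lambda>j. run_weight S J j * (w / 2) ^ j) \<and>
     (w / 2) * (\<Sum>j. run_weight S J j * (w / 2) ^ j) = 1"
proof (cases "w > 0")
  case True
  define f where "f = (\<lambda>j. run_weight S J j * (w / 2) ^ j)"
  define B where "B = {j. 1 \<le> j \<and> enat j \<le> J}"
  define C where "C = {j. enat j > J}"
  have nn: "0 \<le> f j" for j using True by (simp add: f_def run_weight_nonneg)
  have split: "UNIV = (insert 0 B) \<union> C" "(insert 0 B) \<inter> C = {}" "0 \<notin> B"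
    by (auto simp: B_def C_def not_less zero_enat_def[symmetric])
  have fB: "(\<lambda>j. (w / 2) ^ j * zcoeff S j) summable_on B \<longleftrightarrow> f summable_on B"
    by (rule summable_on_cong) (auto simp: B_def f_def run_weight_def)
  have fC: "(\<lambda>j. (w / 2) ^ j) summable_on C \<longleftrightarrow> f summable_on C"
    by (rule summable_on_cong) (auto simp: C_def f_def run_weight_def)
  have iB: "(\<Sum>\<^sub>\<infinity>j\<in>B. (w / 2) ^ j * zcoeff S j) = infsum f B"
    by (rule infsum_cong) (auto simp: B_def f_def run_weight_def)
  have iC: "(\<Sum>\<^sub>\<infinity>j\<in>C. (w / 2) ^ j) = infsum f C"
    by (rule infsum_cong) (auto simp: C_def f_def run_weight_def)
  have sum_iff: "summable f \<longleftrightarrow> f summable_on B \<and> f summable_on C"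
  proof
    assume "summable f"
    hence "f summable_on UNIV" using summable_on_UNIV_nonneg_real_iff[of f] nn by simp
    thus "f summable_on B \<and> f summable_on C" by (blast intro: summable_on_subset_banach)
  next
    assume "f summable_on B \<and> f summable_on C"
    hence "f summable_on UNIV"
      unfolding split(1) by (intro summable_on_Un_disjoint split) (auto simp: summable_on_insert_iff)
    thus "summable f" using summable_on_UNIV_nonneg_real_iff[of f] nn by simp
  qed
  have val: "suminf f = 1 + infsum f B + infsum f C" if "summable f"
  proof -
    have B: "f summable_on B" and C: "f summable_on C" using that sum_iff by auto
    have "(f has_sum suminf f) UNIV"
      using that nn by (intro sums_nonneg_imp_has_sum) auto
    moreover have "(f has_sum (f 0 + infsum f B + infsum f C)) (insert 0 B \<union> C)"
      using B C split by (intro has_sum_Un_disjoint has_sum_insert) auto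
    ultimately have "suminf f = f 0 + infsum f B + infsum f C"
      using split(1) by (metis has_sum_unique)
    thus ?thesis by (simp add: f_def run_weight_0)
  qed
  show ?thesis
    unfolding positive_root_phi_def phi_def B_def[symmetric] C_def[symmetric] fB fC iB iC
      f_def[symmetric]
    using sum_iff val True by auto
qed (auto simp: positive_root_phi_def)

text \<open>The coefficients lie between 0 and 1, so the series converges for arguments below 1, and the first
two of them equal 1. Hence \<open>t * (1 + t + \<dots>)\<close> is at least 1 already at
\<open>t = 9/10\<close>, inside the interval of convergence, and the intermediate value theorem applies.\<close>

lemma positive_root_phi_exists:
  assumes "S \<noteq> 0"
  shows "\<exists>w. positive_root_phi S J w"
proof -
  let ?c = "run_weight S J"
  have sm: "summable (\<lambda>j. ?c j * t ^ j)" if "0 \<le> t" "t < 1" for t :: real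
  proof (rule summable_comparison_test'[where g = "\<lambda>j. t ^ j"])
    show "summable (\<lambda>j. t ^ j)" using that by (intro summable_geometric) auto
    show "norm (?c j * t ^ j) \<le> t ^ j" for j
      using that run_weight_nonneg[of S J j] run_weight_le_1[of S J j]
      by (auto simp: abs_mult intro!: mult_left_le_one_le)
  qed
  have cont: "isCont (\<lambda>t. t * (\<Sum>j. ?c j * t ^ j)) t" if "0 \<le> t" "t \<le> 9/10" for t
    using that by (intro continuous_intros isCont_powser[where K = "95/100"] sm) auto
  have "(\<Sum>j\<in>{0,1}. ?c j * (9/10) ^ j) \<le> (\<Sum>j. ?c j * (9/10) ^ j)"
    by (rule sum_le_suminf) (auto intro!: sm run_weight_nonneg mult_nonneg_nonneg)
  hence "1 \<le> (9/10) * (\<Sum>j. ?c j * (9/10) ^ j)"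
    using run_weight_0[of S J] run_weight_1[OF assms, of J] by simp
  then obtain t where t: "0 \<le> t" "t \<le> 9/10" "t * (\<Sum>j. ?c j * t ^ j) = 1"
    using IVT[of "\<lambda>t. t * (\<Sum>j. ?c j * t ^ j)" 0 1 "9/10"] cont by auto
  have "positive_root_phi S J (2 * t)"
    unfolding positive_root_phi_iff using t sm[of t] by (cases "t = 0") auto
  thus ?thesis ..
qed

text \<open>The function \<open>t * (\<Sum>j. c j * t ^ j)\<close> with \<open>c j \<ge> 0\<close> is strictly
increasing for \<open>t > 0\<close>, wherever it converges to a positive value.\<close>

lemma positive_root_phi_unique:
  assumes "positive_root_phi S J v" "positive_root_phi S J w"
  shows "v = w"
proof -
  have False if v: "positive_root_phi S J v" and w: "positive_root_phi S J w" and "v < w" for v w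
  proof -
    let ?F = "\<lambda>w. \<Sum>j. run_weight S J j * (w / 2) ^ j"
    have "0 < v" using v by (simp add: positive_root_phi_iff)
    have "?F v \<le> ?F w"
      using v w \<open>v < w\<close> unfolding positive_root_phi_iff
      by (intro suminf_le mult_left_mono power_mono run_weight_nonneg) auto
    moreover have "v / 2 * ?F v = 1" "w / 2 * ?F w = 1"
      using v w by (auto simp: positive_root_phi_iff)
    moreover from this have "0 < ?F v" using \<open>0 < v\<close> by (metis divide_pos_pos zero_less_mult_pos zero_less_numeral zero_less_one)
    ultimately have "v / 2 * ?F v < w / 2 * ?F w"
      using \<open>v < w\<close> \<open>0 < v\<close> by (intro mult_less_le_imp_less) auto
    thus False using \<open>v / 2 * ?F v = 1\<close> \<open>w / 2 * ?F w = 1\<close> by simp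
  qed
  thus ?thesis using assms by (metis linorder_less_linear)
qed

lemma w_c_eqI:
  assumes "positive_root_phi S J w"
  shows "w_c S J = w"
  unfolding w_c_def using assms by (intro Least_equality) (auto dest: positive_root_phi_unique)

text \<open>This makes the map behind the vector equation a contraction in
\<open>qve_solution_imaginary_axis\<close>, all the way down to the claimed edge.\<close>

lemma positive_root_phi_lt_2:
  assumes "S \<noteq> 0" "positive_root_phi S J w"
  shows "w < 2"
proof -
  let ?f = "\<lambda>j. run_weight S J j * (w / 2) ^ j"
  have w: "0 < w" "summable ?f" "w / 2 * suminf ?f = 1"
    using assms(2) by (auto simp: positive_root_phi_iff)
  have "(\<Sum>j\<in>{0,1}. ?f j) \<le> suminf ?f"
    by (rule sum_le_suminf[OF w(2)]) (use w(1) in \<open>auto intro!: mult_nonneg_nonneg run_weight_nonneg\<close>)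
  hence "1 + w / 2 \<le> suminf ?f"
    using run_weight_0[of S J] run_weight_1[OF assms(1), of J] by simp
  hence "w / 2 * (1 + w / 2) \<le> 1"
    using w(1,3) mult_left_mono[of "1 + w/2" "suminf ?f" "w/2"] by simp
  hence "w / 2 * 1 < 1"
    using mult_pos_pos[of "w / 2" "w / 2"] w(1) unfolding distrib_left by linarith
  thus ?thesis by simp
qed

section \<open>Expansion of the solution at infinity\<close>

text \<open>The coefficients of \<open>-m\<close> at infinity, \<open>-m z = (\<Sum>n. M\<^sub>n / z ^ (2*n+1))\<close>, where
the product of vectors is componentwise. The recursion is the vector equation in the form
\<open>g = 1/z + g * (S g) / z\<close> for \<open>g = -m\<close>. Combinatorially, component \<open>x\<close> is the total
weight of all plane trees with \<open>n\<close> edges, vertex labels and root label \<open>x\<close>, where an edge from a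
parent labelled \<open>y\<close> to a child labelled \<open>y'\<close> has weight \<open>S $ y $ y'\<close>. The contour walks of these
trees are Dyck paths of length \<open>2*n\<close>.\<close>

fun qve_moment :: "real^'n^'n \<Rightarrow> nat \<Rightarrow> real^'n" where
  "qve_moment S 0 = 1"
| "qve_moment S (Suc n) = (\<Sum>k\<le>n. qve_moment S k * (S *v qve_moment S (n - k)))"

lemma matrix_vector_mult_mono:
  fixes A :: "real^'n^'m"
  assumes "\<forall>x y. 0 \<le> A $ x $ y" "\<And>y. v $ y \<le> w $ y"
  shows "(A *v v) $ x \<le> (A *v w) $ x"
  unfolding matrix_vector_mult_def using assms by (auto intro!: sum_mono mult_left_mono)

lemma matrix_vector_mult_nonneg:
  fixes A :: "real^'n^'m"
  assumes "\<forall>x y. 0 \<le> A $ x $ y" "\<And>y. 0 \<le> v $ y"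
  shows "0 \<le> (A *v v) $ x"
  using matrix_vector_mult_mono[OF assms(1), of 0 v] assms(2) by simp

lemma qve_moment_nonneg:
  assumes "\<forall>x y. 0 \<le> S $ x $ y"
  shows "0 \<le> qve_moment S n $ x"
proof (induction n arbitrary: x rule: less_induct)
  case (less n)
  show ?case
    using less assms
    by (cases n) (auto intro!: sum_nonneg mult_nonneg_nonneg matrix_vector_mult_nonneg)
qed

lemma qve_moment_Suc_times_power:
  "qve_moment S (Suc n) $ x * v ^ n =
    (\<Sum>i\<le>n. (qve_moment S i $ x * v ^ i) * ((S *v qve_moment S (n - i)) $ x * v ^ (n - i)))"
proof -
  have "v ^ n = v ^ i * v ^ (n - i)" if "i \<le> n" for i
    using that by (simp flip: power_add)
  thus ?thesis
    unfolding qve_moment.simps sum_component sum_distrib_right by (intro sum.cong) simp_all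
qed

text \<open>Inserting the inequality into itself \<open>k\<close> times compares \<open>h\<close> with the first \<open>k\<close> terms of the
Neumann series of \<open>1 - \<alpha> S\<close>. The remainder \<open>\<alpha>\<^sup>k S\<^sup>k h\<close> vanishes in the limit, because the
series of norms converges. In this way the
norms of the powers of \<open>S\<close> come in instead of the powers of its norm.\<close>

lemma resolvent_bound:
  fixes S :: "real^'n^'n" and h :: "real^'n"
  assumes "\<forall>x y. 0 \<le> S $ x $ y" "0 \<le> \<alpha>"
    and h: "\<And>x. h $ x \<le> 1 + \<alpha> * (S *v h) $ x"
    and sm: "summable (\<lambda>j. \<alpha> ^ j * max_row_sum_norm (matrix_power S j))"
  shows "h $ x \<le> (\<Sum>j. \<alpha> ^ j * max_row_sum_norm (matrix_power S j))"
proof -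
  have *: "h $ x \<le> (\<Sum>j<k. \<alpha> ^ j * (matrix_power S j *v 1) $ x) + \<alpha> ^ k * (matrix_power S k *v h) $ x"
    for k x
  proof (induction k arbitrary: x)
    case (Suc k)
    let ?r = "(\<Sum>j<k. \<alpha> ^ j *\<^sub>R (matrix_power S j *v 1)) + \<alpha> ^ k *\<^sub>R (matrix_power S k *v h)"
    have "h $ x \<le> 1 + \<alpha> * (S *v h) $ x" by (rule h)
    also have "(S *v h) $ x \<le> (S *v ?r) $ x"
      by (rule matrix_vector_mult_mono[OF assms(1)]) (use Suc in simp)
    also have "S *v ?r = (\<Sum>j<k. \<alpha> ^ j *\<^sub>R (matrix_power S (Suc j) *v 1))
        + \<alpha> ^ k *\<^sub>R (matrix_power S (Suc k) *v h)"
      by (simp add: matrix_vector_right_distrib matrix_vector_mul_assoc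
          linear_sum[OF matrix_vector_mul_linear] matrix_vector_mult_scaleR)
    also have "1 + \<alpha> * \<dots> $ x = (\<Sum>j<Suc k. \<alpha> ^ j * (matrix_power S j *v 1) $ x)
        + \<alpha> ^ Suc k * (matrix_power S (Suc k) *v h) $ x"
      unfolding sum.lessThan_Suc_shift by (simp add: distrib_left sum_distrib_left mult.assoc)
    finally show ?case using assms(2) by (simp add: mult_left_mono)
  qed simp
  define c where "c = Max (range (\<lambda>x. \<bar>h $ x\<bar>))"
  have c: "\<bar>h $ x\<bar> \<le> c" for x
    unfolding c_def by (rule Max_ge) auto
  let ?a = "\<lambda>j. \<alpha> ^ j * max_row_sum_norm (matrix_power S j)"
  have "h $ x \<le> (\<Sum>j<k. ?a j) + ?a k * c" for k
  proof -
    have "(matrix_power S j *v 1) $ x \<le> max_row_sum_norm (matrix_power S j)" for j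
      using abs_matrix_vector_mult_le[of 1 1 "matrix_power S j" x] by simp
    moreover have "(matrix_power S k *v h) $ x \<le> max_row_sum_norm (matrix_power S k) * c"
      using abs_matrix_vector_mult_le[of h c "matrix_power S k" x] c by simp
    ultimately show ?thesis
      using assms(2) unfolding mult.assoc
      by (intro order_trans[OF *[of x k]] add_mono sum_mono mult_left_mono) auto
  qed
  moreover have "(\<lambda>k. (\<Sum>j<k. ?a j) + ?a k * c) \<longlonglongrightarrow> suminf ?a + 0 * c"
    by (intro tendsto_intros summable_LIMSEQ summable_LIMSEQ_zero sm)
  ultimately show ?thesis by (intro LIMSEQ_le_const[of _ "suminf ?a"]) auto
qed

text \<open>The heart of the proof. Let \<open>G\<^sub>n\<close> be the partial sum, which approximates \<open>z * g z\<close> at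
\<open>u = 1 / z\<^sup>2\<close>. The recursion gives \<open>G\<^sub>n\<^sub>+\<^sub>1 \<le> 1 + u * G\<^sub>n * (S G\<^sub>n\<^sub>+\<^sub>1)\<close>. Bounding only
the first factor by \<open>\<gamma>\<close> leaves an inequality that is linear in \<open>G\<^sub>n\<^sub>+\<^sub>1\<close>, and the
Neumann series bounds \<open>G\<^sub>n\<^sub>+\<^sub>1\<close> by \<open>\<gamma>\<close> again. Its term of index \<open>j\<close> accounts for the Dyck paths
that begin with a maximal up-run of length \<open>j\<close>. Working with partial sums avoids any
prior knowledge of convergence.\<close>

lemma qve_moment_partial_sum_le:
  fixes S :: "real^'n^'n"
  assumes S: "\<forall>x y. 0 \<le> S $ x $ y" and "0 < u" "0 < \<gamma>"
    and sm: "summable (\<lambda>j. (u * \<gamma>) ^ j * max_row_sum_norm (matrix_power S j))"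
    and le: "(\<Sum>j. (u * \<gamma>) ^ j * max_row_sum_norm (matrix_power S j)) \<le> \<gamma>"
    and "1 \<le> \<gamma>"
  shows "(\<Sum>k\<le>n. qve_moment S k $ x * u ^ k) \<le> \<gamma>"
proof (induction n arbitrary: x)
  case 0
  show ?case using assms by simp
next
  case (Suc n)
  define G :: "nat \<Rightarrow> real^'n" where "G n = (\<Sum>k\<le>n. u ^ k *\<^sub>R qve_moment S k)" for n
  note nn = qve_moment_nonneg[OF S]
  have G: "G n $ x = (\<Sum>k\<le>n. qve_moment S k $ x * u ^ k)" for n x
    by (simp add: G_def mult.commute)
  have SG: "(S *v G n) $ x = (\<Sum>k\<le>n. (S *v qve_moment S k) $ x * u ^ k)" for n x
    by (simp add: G_def linear_sum[OF matrix_vector_mul_linear] matrix_vector_mult_scaleR mult.commute)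
  note Snn = matrix_vector_mult_nonneg[OF S nn]
  have "G (Suc n) $ x \<le> 1 + (u * \<gamma>) * (S *v G (Suc n)) $ x" for x
  proof -
    let ?a = "\<lambda>k. qve_moment S k $ x * u ^ k" and ?b = "\<lambda>k. (S *v qve_moment S k) $ x * u ^ k"
    have "G (Suc n) $ x = 1 + (\<Sum>k\<le>n. qve_moment S (Suc k) $ x * u ^ Suc k)"
      unfolding G sum.atMost_Suc_shift by simp
    also have "(\<Sum>k\<le>n. qve_moment S (Suc k) $ x * u ^ Suc k) = u * (\<Sum>k\<le>n. \<Sum>i\<le>k. ?a i * ?b (k - i))"
      unfolding qve_moment_Suc_times_power[symmetric] by (simp add: sum_distrib_left mult_ac)
    also have "(\<Sum>k\<le>n. \<Sum>i\<le>k. ?a i * ?b (k - i)) = (\<Sum>(i, j)\<in>{(i, j). i + j \<le> n}. ?a i * ?b j)"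
      by (rule sum.triangle_reindex_eq[symmetric])
    also have "\<dots> \<le> (\<Sum>(i, j)\<in>{..n} \<times> {..Suc n}. ?a i * ?b j)"
      using nn Snn assms(2) by (intro sum_mono2) auto
    also have "\<dots> = (\<Sum>i\<le>n. \<Sum>j\<le>Suc n. ?a i * ?b j)"
      by (rule sum.cartesian_product[symmetric])
    also have "\<dots> = G n $ x * (S *v G (Suc n)) $ x"
      unfolding G SG sum_product ..
    also have "\<dots> \<le> \<gamma> * (S *v G (Suc n)) $ x"
    proof (rule mult_right_mono)
      show "0 \<le> (S *v G (Suc n)) $ x"
        unfolding SG using Snn assms(2) by (intro sum_nonneg mult_nonneg_nonneg) auto
    qed (use Suc.IH in \<open>simp add: G\<close>)
    finally show ?thesis using assms(2) by (simp add: mult.assoc)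
  qed
  hence "G (Suc n) $ x \<le> (\<Sum>j. (u * \<gamma>) ^ j * max_row_sum_norm (matrix_power S j))"
    using assms by (intro resolvent_bound) auto
  thus ?case using le unfolding G by simp
qed

text \<open>At \<open>\<gamma> = 2 / w\<close> and \<open>u * \<gamma> = (w / 2) / max_row_sum_norm S\<close> the Neumann series is the one in
\<^const>\<open>phi\<close> for infinite \<open>J\<close>, and a root of \<^const>\<open>phi\<close> is what makes \<open>\<gamma>\<close>
reproduce itself. For finite \<open>J\<close> the coefficients only become larger.\<close>

lemma summable_qve_moment:
  fixes S :: "real^'n^'n"
  assumes S: "\<forall>x y. 0 \<le> S $ x $ y" and "S \<noteq> 0" and "positive_root_phi S J w"
  defines "u \<equiv> (w / 2)\<^sup>2 / max_row_sum_norm S"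
  shows "summable (\<lambda>n. qve_moment S n $ x * u ^ n)"
    and "(\<Sum>n. qve_moment S n $ x * u ^ n) \<le> 2 / w"
proof -
  define s where "s = max_row_sum_norm S"
  have s: "0 < s" using max_row_sum_norm_pos[OF \<open>S \<noteq> 0\<close>] by (simp add: s_def)
  have w: "0 < w" "summable (\<lambda>j. run_weight S J j * (w / 2) ^ j)"
    "(w / 2) * (\<Sum>j. run_weight S J j * (w / 2) ^ j) = 1" "w < 2"
    using assms(3) positive_root_phi_lt_2[OF assms(2,3)] unfolding positive_root_phi_iff by auto
  have eq: "(u * (2 / w)) ^ j * max_row_sum_norm (matrix_power S j) = zcoeff S j * (w / 2) ^ j" for j
    using s w(1) by (simp add: u_def zcoeff_def s_def[symmetric] field_simps power2_eq_square)
  have sm: "summable (\<lambda>j. zcoeff S j * (w / 2) ^ j)"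
    by (rule summable_comparison_test'[OF w(2)])
       (use w(1) zcoeff_le_run_weight in
          \<open>auto simp: abs_mult abs_of_nonneg[OF zcoeff_nonneg] intro!: mult_right_mono\<close>)
  have "(\<Sum>j. zcoeff S j * (w / 2) ^ j) \<le> (\<Sum>j. run_weight S J j * (w / 2) ^ j)"
    using w(1) by (intro suminf_le sm w(2) mult_right_mono zcoeff_le_run_weight) auto
  also have "\<dots> = 2 / w" using w(1,3) by (simp add: field_simps)
  finally have le: "(\<Sum>j. zcoeff S j * (w / 2) ^ j) \<le> 2 / w" .
  have u: "0 < u" using s w(1) by (simp add: u_def s_def)
  have bd: "(\<Sum>k\<le>n. qve_moment S k $ x * u ^ k) \<le> 2 / w" for n
    by (rule qve_moment_partial_sum_le[OF S u, of "2 / w", unfolded eq]) (use w sm le in auto)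
  show sm': "summable (\<lambda>n. qve_moment S n $ x * u ^ n)"
  proof (rule bounded_imp_summable)
    show "(\<Sum>k\<le>n. qve_moment S k $ x * u ^ k) \<le> 2 / w" for n by (rule bd)
  qed (use u qve_moment_nonneg[OF S] in auto)
  show "(\<Sum>n. qve_moment S n $ x * u ^ n) \<le> 2 / w"
    by (rule LIMSEQ_le_const2[OF summable_LIMSEQ'[OF sm']]) (use bd in auto)
qed

text \<open>The recursion for the coefficients is a Cauchy product, so the series solves the vector equation
wherever it converges absolutely. With \<open>v = 1 / z\<^sup>2\<close> this is the equation for \<open>-z * m z\<close>.\<close>

lemma qve_moment_series_eq:
  fixes S :: "real^'n^'n"
  assumes sm: "\<And>x. summable (\<lambda>n. norm (qve_moment S n $ x * v ^ n))"
  defines "q \<equiv> (\<chi> x. \<Sum>n. qve_moment S n $ x * v ^ n)"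
  shows "q $ x = 1 + v * q $ x * (S *v q) $ x"
proof -
  let ?a = "\<lambda>x n. qve_moment S n $ x * v ^ n" and ?b = "\<lambda>n. (S *v qve_moment S n) $ x * v ^ n"
  have b: "?b n = (\<Sum>y\<in>UNIV. S $ x $ y * ?a y n)" for n
    by (simp add: matrix_vector_mult_def sum_distrib_right mult.assoc)
  have "summable (\<lambda>n. \<Sum>y\<in>UNIV. \<bar>S $ x $ y\<bar> * \<bar>?a y n\<bar>)"
    using sm by (intro summable_sum summable_mult) auto
  hence smb: "summable (\<lambda>n. norm (?b n))"
    by (rule summable_comparison_test'[where N=0]) 
       (auto simp: b abs_mult intro!: order_trans[OF sum_abs])
  have Sq: "(\<Sum>n. ?b n) = (S *v q) $ x"
    unfolding b
    by (subst suminf_sum)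
       (simp_all add: matrix_vector_mult_def q_def suminf_mult summable_mult summable_norm_cancel[OF sm])
  have "q $ x = 1 + (\<Sum>n. ?a x (Suc n))"
    unfolding q_def using suminf_split_head[OF summable_norm_cancel[OF sm[of x]]] by simp
  also have "(\<Sum>n. ?a x (Suc n)) = (\<Sum>n. v * (\<Sum>i\<le>n. ?a x i * ?b (n - i)))"
    unfolding qve_moment_Suc_times_power[symmetric] by (simp add: mult_ac)
  also have "\<dots> = v * (\<Sum>n. \<Sum>i\<le>n. ?a x i * ?b (n - i))"
    by (rule suminf_mult[OF summable_Cauchy_product[OF sm smb]])
  also have "(\<Sum>n. \<Sum>i\<le>n. ?a x i * ?b (n - i)) = (\<Sum>n. ?a x n) * (\<Sum>n. ?b n)"
    by (rule Cauchy_product[OF sm smb, symmetric])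
  finally show ?thesis by (simp add: Sq q_def)
qed

section \<open>The solution on the imaginary axis\<close>

text \<open>Subtracting the two equations gives \<open>n - m = m * n * S (n - m)\<close> (componentwise products), a
contraction for the maximum norm. The two solutions may obey different bounds \<open>a\<close> and
\<open>b\<close>: a positive imaginary part gives the better bound for one of them, the convergence of the series a
bound for the other.\<close>

lemma vector_equation_small_solution_unique:
  fixes S :: "real^'n^'n" and m n :: "complex^'n"
  assumes m: "\<And>x. m $ x * (z + (\<Sum>y\<in>UNIV. of_real (S $ x $ y) * m $ y)) = -1"
    and n: "\<And>x. n $ x * (z + (\<Sum>y\<in>UNIV. of_real (S $ x $ y) * n $ y)) = -1"
    and "\<And>x. norm (m $ x) \<le> a" "\<And>x. norm (n $ x) \<le> b"
    and small: "max_row_sum_norm S * (a * b) < 1"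
  shows "m = n"
proof -
  define d where "d = (\<chi> x. norm (m $ x - n $ x))"
  define D where "D = Max (range (\<lambda>x. d $ x))"
  have d_le: "\<bar>d $ x\<bar> \<le> D" for x
    unfolding D_def by (subst abs_of_nonneg) (auto simp: d_def)
  have d0: "0 \<le> d $ x" for x by (simp add: d_def)
  have ab: "0 \<le> a" "0 \<le> b"
    by (rule order_trans[OF norm_ge_zero assms(3)], rule order_trans[OF norm_ge_zero assms(4)])
  have "d $ x \<le> (max_row_sum_norm S * (a * b)) * D" for x
  proof -
    let ?Sm = "\<Sum>y\<in>UNIV. of_real (S $ x $ y) * m $ y" and ?Sn = "\<Sum>y\<in>UNIV. of_real (S $ x $ y) * n $ y"
    have "m $ x * n $ x * (?Sn - ?Sm) = m $ x * (n $ x * (z + ?Sn)) - n $ x * (m $ x * (z + ?Sm))"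
      by (simp add: algebra_simps)
    also have "\<dots> = n $ x - m $ x" unfolding m n by simp
    finally have diff: "m $ x * n $ x * (?Sn - ?Sm) = n $ x - m $ x" .
    have "d $ x = norm (m $ x) * norm (n $ x) * norm (?Sn - ?Sm)"
      unfolding norm_mult[symmetric] diff by (simp add: d_def norm_minus_commute)
    moreover have "norm (?Sn - ?Sm) \<le> max_row_sum_norm S * D"
    proof -
      have "norm (?Sn - ?Sm) \<le> (\<Sum>y\<in>UNIV. \<bar>S $ x $ y\<bar> * d $ y)"
        unfolding sum_subtractf[symmetric] right_diff_distrib[symmetric] d_def
        by (rule order_trans[OF norm_sum]) (simp add: norm_mult norm_minus_commute)
      also have "\<dots> \<le> (\<Sum>y\<in>UNIV. \<bar>S $ x $ y\<bar> * D)"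
        using d_le by (intro sum_mono mult_left_mono) (auto intro: abs_le_D1)
      also have "\<dots> \<le> max_row_sum_norm S * D"
        unfolding sum_distrib_right[symmetric]
        using d_le[of undefined] by (intro mult_right_mono row_sum_le_max_row_sum_norm) auto
      finally show ?thesis .
    qed
    hence "norm (m $ x) * norm (n $ x) * norm (?Sn - ?Sm) \<le> (a * b) * (max_row_sum_norm S * D)"
      using assms(3,4) ab by (intro mult_mono mult_nonneg_nonneg) auto
    ultimately show ?thesis by (simp add: mult_ac)
  qed
  moreover have "D \<in> range (\<lambda>x. d $ x)" unfolding D_def by (rule Max_in) auto
  then obtain x where "D = d $ x" by blast
  ultimately have "D \<le> (max_row_sum_norm S * (a * b)) * D" by metis
  moreover have "(max_row_sum_norm S * (a * b)) * D < D" if "0 < D"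
    using mult_strict_right_mono[OF small that] by simp
  ultimately have "D \<le> 0" by (metis not_less)
  hence "d $ x = 0" for x using d_le[of x] by simp
  thus ?thesis by (simp add: d_def vec_eq_iff)
qed

text \<open>\<open>Im (- 1 / m)\<close> is at least \<open>Im z\<close>, since \<open>S m\<close> contributes a nonnegative imaginary part.\<close>

lemma qve_solution_norm_le:
  assumes S: "\<forall>x y. 0 \<le> S $ x $ y" and "qve_solution S m" "0 < Im z"
  shows "norm (m z $ x) \<le> 1 / Im z"
proof -
  have pos: "0 < Im (m z $ y)" for y using assms by (auto simp: qve_solution_def)
  have "Im z \<le> Im (z + (\<Sum>y\<in>UNIV. of_real (S $ x $ y) * m z $ y))"
    using S pos by (auto intro!: sum_nonneg mult_nonneg_nonneg less_imp_le[OF pos])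
  also have "\<dots> = Im (- 1 / m z $ x)" using assms by (auto simp: qve_solution_def)
  also have "\<dots> \<le> norm (- 1 / m z $ x)" using abs_Im_le_cmod abs_le_D1 by blast
  also have "\<dots> = 1 / norm (m z $ x)" by (simp add: norm_divide)
  finally have "Im z \<le> 1 / norm (m z $ x)" .
  moreover have "0 < norm (m z $ x)" using pos[of x] by auto
  ultimately show ?thesis using assms(3) by (simp add: field_simps)
qed

text \<open>At \<open>z = \<i> * \<eta>\<close> the variable of the series is the negative real number \<open>-1 / \<eta>\<^sup>2\<close>, so the series
yields the purely imaginary solution \<open>\<i> * q / \<eta>\<close> with real \<open>q\<close>, and contraction identifies
it with \<open>m\<close>. Uniqueness near infinity suffices because the moments of the measure are determined there.\<close>

lemma qve_solution_imaginary_axis: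
  fixes S :: "real^'n^'n"
  assumes S: "\<forall>x y. 0 \<le> S $ x $ y" and "S \<noteq> 0" and root: "positive_root_phi S J w"
    and sol: "qve_solution S m" and \<eta>: "2 * (sqrt (max_row_sum_norm S) / w) < \<eta>"
  shows "summable (\<lambda>n. qve_moment S n $ x * (- (1 / \<eta>\<^sup>2)) ^ n)"
    and "m (\<i> * of_real \<eta>) $ x = \<i> * of_real ((\<Sum>n. qve_moment S n $ x * (- (1 / \<eta>\<^sup>2)) ^ n) / \<eta>)"
proof -
  define s where "s = max_row_sum_norm S"
  define u where "u = (w / 2)\<^sup>2 / s"
  define v where "v = - (1 / \<eta>\<^sup>2)"
  have s: "0 < s" using max_row_sum_norm_pos[OF \<open>S \<noteq> 0\<close>] by (simp add: s_def)
  have w: "0 < w" "w < 2" using root positive_root_phi_lt_2[OF \<open>S \<noteq> 0\<close> root] by (auto simp: positive_root_phi_iff)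
  have "0 < 2 * (sqrt s / w)" using s w by simp
  hence \<eta>0: "0 < \<eta>" using \<eta> by (simp add: s_def)
  have "(2 * (sqrt s / w))\<^sup>2 < \<eta>\<^sup>2"
    using \<eta> \<open>0 < 2 * (sqrt s / w)\<close> by (intro power_strict_mono) (auto simp: s_def)
  moreover have "(2 * (sqrt s / w))\<^sup>2 = 1 / u"
    using s by (simp add: u_def power_mult_distrib power_divide)
  ultimately have "1 / u < \<eta>\<^sup>2" by simp
  moreover have u: "0 < u" using s w by (simp add: u_def)
  ultimately have vu: "\<bar>v\<bar> < u"
    using \<eta>0 by (simp add: v_def field_simps)
  note nn = qve_moment_nonneg[OF S]
  note sm_u = summable_qve_moment[OF S \<open>S \<noteq> 0\<close> root, folded s_def, folded u_def]
  have le: "norm (qve_moment S n $ x * v ^ n) \<le> qve_moment S n $ x * u ^ n" for n x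
    using vu nn[of n x] by (simp add: abs_mult power_abs mult_left_mono power_mono)
  have sm: "summable (\<lambda>n. norm (qve_moment S n $ x * v ^ n))" for x
    by (rule summable_comparison_test'[OF sm_u(1)]) (use le in auto)
  show "summable (\<lambda>n. qve_moment S n $ x * (- (1 / \<eta>\<^sup>2)) ^ n)"
    using summable_norm_cancel[OF sm] by (simp add: v_def)
  define q where "q = (\<chi> x. \<Sum>n. qve_moment S n $ x * v ^ n)"
  have q_eq: "q $ x = 1 + v * q $ x * (S *v q) $ x" for x
    unfolding q_def by (rule qve_moment_series_eq[OF sm])
  have q_le: "\<bar>q $ x\<bar> \<le> 2 / w" for x
  proof -
    have "\<bar>q $ x\<bar> \<le> (\<Sum>n. norm (qve_moment S n $ x * v ^ n))"
      unfolding q_def using summable_norm[OF sm[of x]] by simp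
    also have "\<dots> \<le> (\<Sum>n. qve_moment S n $ x * u ^ n)"
      by (rule suminf_le[OF le sm sm_u(1)])
    finally show ?thesis using sm_u(2)[of x] by simp
  qed
  \<comment> \<open>The bounds \<open>1 / \<eta>\<close> and \<open>2 / (w * \<eta>)\<close> of the two solutions give the contraction factor
    \<open>max_row_sum_norm S * 2 / (w * \<eta>\<^sup>2)\<close>, which at the edge equals \<open>w / 2 < 1\<close>.\<close>
  define n where "n = (\<chi> x. \<i> * of_real (q $ x / \<eta>))"
  have "m (\<i> * of_real \<eta>) = n"
  proof (rule vector_equation_small_solution_unique)
    show "m (\<i> * of_real \<eta>) $ x * (\<i> * of_real \<eta> +
       (\<Sum>y\<in>UNIV. of_real (S $ x $ y) * m (\<i> * of_real \<eta>) $ y)) = -1" for x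
    proof -
      have "0 < Im (m (\<i> * of_real \<eta>) $ x)"
        and e: "- 1 / (m (\<i> * of_real \<eta>) $ x)
          = \<i> * of_real \<eta> + (\<Sum>y\<in>UNIV. of_real (S $ x $ y) * m (\<i> * of_real \<eta>) $ y)"
        using sol \<eta>0 by (auto simp: qve_solution_def)
      hence "m (\<i> * of_real \<eta>) $ x \<noteq> 0" by auto
      thus ?thesis unfolding e[symmetric] by simp
    qed
    show "n $ x * (\<i> * of_real \<eta> + (\<Sum>y\<in>UNIV. of_real (S $ x $ y) * n $ y)) = -1" for x
    proof -
      have "(\<Sum>y\<in>UNIV. of_real (S $ x $ y) * n $ y) = \<i> * of_real ((S *v q) $ x / \<eta>)"
        by (simp add: n_def matrix_vector_mult_def sum_distrib_left sum_divide_distrib mult_ac)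
      hence "n $ x * (\<i> * of_real \<eta> + (\<Sum>y\<in>UNIV. of_real (S $ x $ y) * n $ y))
          = - of_real (q $ x / \<eta> * (\<eta> + (S *v q) $ x / \<eta>))"
        by (simp add: n_def algebra_simps)
      also have "q $ x / \<eta> * (\<eta> + (S *v q) $ x / \<eta>) = q $ x - v * q $ x * (S *v q) $ x"
        using \<eta>0 by (simp add: v_def field_simps power2_eq_square)
      also have "\<dots> = 1" using q_eq[of x] by linarith
      finally show ?thesis by simp
    qed
    show "norm (m (\<i> * of_real \<eta>) $ x) \<le> 1 / \<eta>" for x
      using qve_solution_norm_le[OF S sol, of "\<i> * of_real \<eta>" x] \<eta>0 by simp
    show "norm (n $ x) \<le> 2 / w / \<eta>" for x
      using divide_right_mono[OF q_le[of x], of \<eta>] \<eta>0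
      by (simp add: n_def norm_mult norm_divide)
    have "s * (1 / \<eta> * (2 / w / \<eta>)) = s * (2 / w) * \<bar>v\<bar>"
      by (simp add: v_def power2_eq_square)
    also have "\<dots> < s * (2 / w) * u" using vu s w by (intro mult_strict_left_mono) auto
    also have "\<dots> = w / 2" using s w by (simp add: u_def power2_eq_square)
    finally show "max_row_sum_norm S * (1 / \<eta> * (2 / w / \<eta>)) < 1" using w by (simp add: s_def)
  qed
  thus "m (\<i> * of_real \<eta>) $ x = \<i> * of_real ((\<Sum>n. qve_moment S n $ x * (- (1 / \<eta>\<^sup>2)) ^ n) / \<eta>)"
    by (simp add: n_def q_def v_def)
qed

section \<open>From the Stieltjes transform to moments and support\<close>

text \<open>Once the coefficients below \<open>n\<close> agree, division by \<open>t ^ n\<close> and the limit from the right at 0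
isolate the next one. A one-sided neighbourhood is all that is available, as \<open>t = 1 / \<eta>\<^sup>2\<close> is positive.\<close>

lemma real_powser_eq_right_imp_coeffs_eq:
  fixes a b :: "nat \<Rightarrow> real"
  assumes "0 < \<epsilon>"
    and a: "\<And>t. 0 < t \<Longrightarrow> t < \<epsilon> \<Longrightarrow> (\<lambda>n. a n * t ^ n) sums f t"
    and b: "\<And>t. 0 < t \<Longrightarrow> t < \<epsilon> \<Longrightarrow> (\<lambda>n. b n * t ^ n) sums f t"
  shows "a n = b n"
proof (induction n rule: less_induct)
  case (less n)
  define c where "c k = a (k + n) - b (k + n)" for k
  have c: "(\<lambda>k. c k * t ^ k) sums 0" if t: "0 < t" "t < \<epsilon>" for t
  proof -
    have "(\<lambda>k. (a k - b k) * t ^ k) sums (f t - f t)"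
      using sums_diff[OF a[OF t] b[OF t]] by (simp add: left_diff_distrib)
    hence "(\<lambda>k. (a (k + n) - b (k + n)) * t ^ (k + n)) sums (0 - (\<Sum>k<n. (a k - b k) * t ^ k))"
      by (subst sums_iff_shift) simp
    also have "(\<Sum>k<n. (a k - b k) * t ^ k) = 0" using less by simp
    finally have "(\<lambda>k. inverse (t ^ n) * (c k * t ^ k * t ^ n)) sums (inverse (t ^ n) * 0)"
      by (intro sums_mult) (simp add: c_def power_add mult.assoc)
    thus ?thesis using t by (simp add: mult_ac)
  qed
  have "isCont (\<lambda>t. \<Sum>k. c k * t ^ k) 0"
    by (rule isCont_powser[where K = "\<epsilon> / 2"])
       (use assms(1) in \<open>auto intro!: sums_summable c\<close>)
  hence "((\<lambda>t. \<Sum>k. c k * t ^ k) \<longlongrightarrow> c 0) (at_right 0)"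
    unfolding isCont_def by (simp add: filterlim_at_split)
  moreover have "eventually (\<lambda>t. (\<Sum>k. c k * t ^ k) = 0) (at_right 0)"
    unfolding eventually_at_right_field using assms(1) sums_unique[OF c, symmetric]
    by (auto intro!: exI[of _ \<epsilon>])
  ultimately have "((\<lambda>t. 0) \<longlongrightarrow> c 0) (at_right (0::real))"
    by (rule Lim_transform_eventually)
  hence "c 0 = 0" by (simp add: tendsto_const_iff)
  thus ?case by (simp add: c_def)
qed

text \<open>The complement of the support is a union of open null sets, hence of countably many of them.\<close>

lemma AE_msupp:
  assumes "sets \<rho> = sets borel"
  shows "AE \<tau> in \<rho>. \<tau> \<in> msupp \<rho>"
proof -
  define F where "F = {U. open U \<and> emeasure \<rho> U = 0}"
  obtain F' where F': "F' \<subseteq> F" "countable F'" "\<Union>F' = \<Union>F"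
    using Lindelof[of F] by (auto simp: F_def)
  have "\<Union>F' \<in> null_sets \<rho>"
  proof -
    have "(\<Union>U\<in>F'. U) \<in> null_sets \<rho>"
      using F' assms by (intro null_sets_UN') (auto simp: F_def null_sets_def)
    thus ?thesis by simp
  qed
  moreover have "{\<tau> \<in> space \<rho>. \<tau> \<notin> msupp \<rho>} \<subseteq> \<Union>F'"
    unfolding F'(3) by (auto simp: F_def msupp_def)
  ultimately show ?thesis by (rule AE_I')
qed

text \<open>The geometric series for \<open>1 / (1 + t * \<tau>\<^sup>2)\<close> converges uniformly on the bounded support and is integrated
termwise. Up to scaling, this integral is the imaginary part of the Stieltjes transform at
\<open>\<i> / sqrt t\<close>.\<close>

lemma even_moments_sums:
  fixes \<rho> :: "real measure"
  assumes "prob_space \<rho>" and sets: "sets \<rho> = sets borel"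
    and bd: "AE \<tau> in \<rho>. \<bar>\<tau>\<bar> \<le> K" and "0 \<le> t" "t * K\<^sup>2 < 1"
  shows "integrable \<rho> (\<lambda>\<tau>. \<tau> ^ (2 * n))"
    and "(\<lambda>n. (LINT \<tau>|\<rho>. \<tau> ^ (2 * n)) * (- t) ^ n) sums (LINT \<tau>|\<rho>. 1 / (1 + t * \<tau>\<^sup>2))"
proof -
  interpret prob_space \<rho> by fact
  note [measurable_cong] = sets
  have pw: "AE \<tau> in \<rho>. \<bar>\<tau> ^ (2 * n)\<bar> \<le> K ^ (2 * n)" for n
    using bd
  proof eventually_elim
    case (elim \<tau>)
    show ?case using power_mono[OF elim abs_ge_zero, of "2 * n"] by (simp only: power_abs)
  qed
  show int: "integrable \<rho> (\<lambda>\<tau>. \<tau> ^ (2 * n))" for n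
    by (rule integrable_const_bound[where B = "K ^ (2 * n)"]) (use pw in auto)
  let ?f = "\<lambda>n \<tau>. \<tau> ^ (2 * n) * (- t) ^ n"
  have geo: "?f n \<tau> = (- (t * \<tau>\<^sup>2)) ^ n" for n \<tau>
    by (metis mult.commute mult_minus_left power_mult power_mult_distrib)
  have small: "AE \<tau> in \<rho>. norm (- (t * \<tau>\<^sup>2)) < 1"
    using bd
  proof eventually_elim
    case (elim \<tau>)
    have "t * \<tau>\<^sup>2 \<le> t * K\<^sup>2"
      using elim assms(4) by (intro mult_left_mono) (auto simp: abs_le_square_iff[symmetric])
    thus ?case using assms(4,5) by simp
  qed
  have int_f: "integrable \<rho> (?f n)" for n using int by simp
  have AE_sm: "AE \<tau> in \<rho>. summable (\<lambda>n. norm (?f n \<tau>))"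
    using small unfolding geo by eventually_elim (simp only: norm_power, rule summable_geometric, simp)
  have sm_int: "summable (\<lambda>n. LINT \<tau>|\<rho>. norm (?f n \<tau>))"
  proof (rule summable_comparison_test'[where g = "\<lambda>n. (t * K\<^sup>2) ^ n"])
    show "summable (\<lambda>n. (t * K\<^sup>2) ^ n)" using assms(4,5) by (intro summable_geometric) auto
    show "norm (LINT \<tau>|\<rho>. norm (?f n \<tau>)) \<le> (t * K\<^sup>2) ^ n" for n
    proof -
      have "(LINT \<tau>|\<rho>. norm (?f n \<tau>)) \<le> (LINT \<tau>|\<rho>. (t * K\<^sup>2) ^ n)"
      proof (rule integral_mono_AE)
        show "AE \<tau> in \<rho>. norm (?f n \<tau>) \<le> (t * K\<^sup>2) ^ n"
          using pw[of n]
        proof eventually_elim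
          case (elim \<tau>)
          have "norm (?f n \<tau>) = t ^ n * \<bar>\<tau> ^ (2 * n)\<bar>"
            using assms(4) by (simp add: abs_mult power_abs)
          also have "\<dots> \<le> t ^ n * K ^ (2 * n)" using elim assms(4) by (intro mult_left_mono) auto
          finally show ?case by (simp add: power_mult_distrib power_mult)
        qed
      qed (use int_f in auto)
      thus ?thesis by (simp add: prob_space)
    qed
  qed
  have "(\<lambda>n. LINT \<tau>|\<rho>. ?f n \<tau>) sums (LINT \<tau>|\<rho>. (\<Sum>n. ?f n \<tau>))"
    unfolding sums_iff using summable_integral[OF int_f AE_sm sm_int]
      integral_suminf[OF int_f AE_sm sm_int] by simp
  also have "(LINT \<tau>|\<rho>. (\<Sum>n. ?f n \<tau>)) = (LINT \<tau>|\<rho>. 1 / (1 + t * \<tau>\<^sup>2))"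
  proof (rule integral_cong_AE)
    show "AE \<tau> in \<rho>. (\<Sum>n. ?f n \<tau>) = 1 / (1 + t * \<tau>\<^sup>2)"
      using small unfolding geo by eventually_elim (simp add: suminf_geometric)
  qed measurable
  finally show "(\<lambda>n. (LINT \<tau>|\<rho>. \<tau> ^ (2 * n)) * (- t) ^ n) sums (LINT \<tau>|\<rho>. 1 / (1 + t * \<tau>\<^sup>2))"
    by simp
qed

text \<open>If a set of points of modulus above \<open>a > b\<close> had positive mass \<open>p\<close>, the moments would be at least
\<open>p * a ^ (2 * n)\<close>, which outgrows \<open>c * b ^ (2 * n)\<close>.\<close>

lemma msupp_bounded_by_even_moments:
  assumes "prob_space \<rho>" and sets: "sets \<rho> = sets borel" and "0 \<le> b"
    and int: "\<And>n. integrable \<rho> (\<lambda>\<tau>. \<tau> ^ (2 * n))"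
    and le: "\<And>n. (LINT \<tau>|\<rho>. \<tau> ^ (2 * n)) \<le> c * b ^ (2 * n)"
    and \<tau>: "\<tau> \<in> msupp \<rho>"
  shows "\<bar>\<tau>\<bar> \<le> b"
proof (rule ccontr)
  interpret prob_space \<rho> by fact
  assume "\<not> \<bar>\<tau>\<bar> \<le> b"
  then obtain a where a: "b < a" "a < \<bar>\<tau>\<bar>" using dense by (metis not_le)
  define U where "U = {x. a < \<bar>x\<bar>}"
  have "open U" unfolding U_def by (intro open_Collect_less continuous_intros)
  hence U: "U \<in> sets \<rho>" "0 < emeasure \<rho> U"
    using sets \<tau> a by (auto simp: msupp_def U_def)
  hence pos: "0 < prob U" by (simp add: emeasure_eq_measure)
  have "prob U \<le> c * ((b / a)\<^sup>2) ^ n" for n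
  proof -
    have "a ^ (2 * n) * prob U = (LINT x|\<rho>. a ^ (2 * n) * indicator U x)"
      using U(1) by simp
    also have "\<dots> \<le> (LINT x|\<rho>. x ^ (2 * n))"
    proof (rule integral_mono[OF _ int])
      show "integrable \<rho> (\<lambda>x. a ^ (2 * n) * indicator U x)"
        using U(1) by (simp add: emeasure_eq_measure)
      show "a ^ (2 * n) * indicator U x \<le> x ^ (2 * n)" for x
        using a \<open>0 \<le> b\<close> power_mono[of a "\<bar>x\<bar>" "2 * n"]
        by (auto simp: indicator_def U_def power_even_abs)
    qed
    also have "\<dots> \<le> c * b ^ (2 * n)" by (rule le)
    finally show ?thesis
      using a \<open>0 \<le> b\<close> by (simp add: power_divide field_simps flip: power_mult)
  qed
  moreover have "(\<lambda>n. c * ((b / a)\<^sup>2) ^ n) \<longlonglongrightarrow> c * 0"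
  proof (intro tendsto_intros LIMSEQ_power_zero)
    show "norm ((b / a)\<^sup>2) < 1" using a \<open>0 \<le> b\<close> by (simp add: power_divide power_strict_mono)
  qed
  ultimately have "prob U \<le> c * 0" by (intro LIMSEQ_le_const) auto
  thus False using pos by simp
qed

lemma dos_stieltjes_imaginary_axis:
  fixes S :: "real^'n^'n"
  assumes S: "\<forall>x y. 0 \<le> S $ x $ y" and "S \<noteq> 0" and root: "positive_root_phi S J w"
    and "prob_space \<rho>" and sets: "sets \<rho> = sets borel" and sol: "qve_solution S m"
    and stieltjes: "\<And>z. Im z > 0 \<Longrightarrow>
       (\<Sum>x\<in>UNIV. m z $ x) / of_nat CARD('n) = (LINT \<tau>|\<rho>. 1 / (of_real \<tau> - z))"
    and t: "0 < t" "t < (w / 2)\<^sup>2 / max_row_sum_norm S"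
  shows "(\<lambda>n. (\<Sum>x\<in>UNIV. qve_moment S n $ x) / CARD('n) * (- t) ^ n) sums (LINT \<tau>|\<rho>. 1 / (1 + t * \<tau>\<^sup>2))"
proof -
  interpret prob_space \<rho> by fact
  note [measurable_cong] = sets
  define s where "s = max_row_sum_norm S"
  have s: "0 < s" using max_row_sum_norm_pos[OF \<open>S \<noteq> 0\<close>] by (simp add: s_def)
  have w: "0 < w" using root by (auto simp: positive_root_phi_iff)
  define \<eta> where "\<eta> = 1 / sqrt t"
  have \<eta>: "0 < \<eta>" "1 / \<eta>\<^sup>2 = t" using t by (auto simp: \<eta>_def power_divide)
  have "sqrt t < sqrt ((w / 2)\<^sup>2 / s)" using t by (simp add: s_def)
  hence "sqrt t < w / 2 / sqrt s" using w by (simp add: real_sqrt_divide)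
  hence large: "2 * (sqrt s / w) < \<eta>"
    using t s w by (simp add: \<eta>_def field_simps)
  let ?q = "\<lambda>x. \<Sum>n. qve_moment S n $ x * (- t) ^ n"
  note axis = qve_solution_imaginary_axis[OF S \<open>S \<noteq> 0\<close> root sol large[unfolded s_def], unfolded \<eta>(2)]
  let ?h = "\<lambda>\<tau>. 1 / (complex_of_real \<tau> - \<i> * of_real \<eta>)"
  have int: "integrable \<rho> ?h"
  proof (rule integrable_const_bound)
    show "AE \<tau> in \<rho>. norm (?h \<tau>) \<le> 1 / \<eta>"
    proof (rule AE_I2)
      fix \<tau>
      have "\<eta> \<le> norm (complex_of_real \<tau> - \<i> * of_real \<eta>)"
        using abs_Im_le_cmod[of "complex_of_real \<tau> - \<i> * of_real \<eta>"] \<eta>(1) by simp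
      thus "norm (?h \<tau>) \<le> 1 / \<eta>" using \<eta>(1) by (simp add: norm_divide frac_le)
    qed
  qed measurable
  have "Im (?h \<tau>) = (1 / (1 + t * \<tau>\<^sup>2)) / \<eta>" for \<tau>
  proof -
    have "Im (?h \<tau>) = \<eta> / (\<tau>\<^sup>2 + \<eta>\<^sup>2)" by (simp add: Im_divide)
    also have "\<tau>\<^sup>2 + \<eta>\<^sup>2 = \<eta>\<^sup>2 * (1 + t * \<tau>\<^sup>2)"
      using \<eta>(1) unfolding \<eta>(2)[symmetric] by (simp add: distrib_left)
    finally show ?thesis using \<eta>(1) by (simp add: power2_eq_square)
  qed
  hence "(LINT \<tau>|\<rho>. 1 / (1 + t * \<tau>\<^sup>2)) / \<eta> = (LINT \<tau>|\<rho>. Im (?h \<tau>))"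
    by (simp only: integral_divide_zero)
  also have "\<dots> = Im (LINT \<tau>|\<rho>. ?h \<tau>)" by (rule integral_Im[OF int])
  also have "\<dots> = Im ((\<Sum>x\<in>UNIV. m (\<i> * of_real \<eta>) $ x) / of_nat CARD('n))"
    using stieltjes[of "\<i> * of_real \<eta>"] \<eta>(1) by simp
  also have "\<dots> = (\<Sum>x\<in>UNIV. ?q x) / CARD('n) / \<eta>"
    unfolding axis(2) by (simp add: sum_divide_distrib Im_divide_of_nat mult.commute)
  finally have eq: "(LINT \<tau>|\<rho>. 1 / (1 + t * \<tau>\<^sup>2)) = (\<Sum>x\<in>UNIV. ?q x) / CARD('n)"
    unfolding divide_cancel_right using \<eta>(1) by simp
  have "(\<lambda>n. (\<Sum>x\<in>UNIV. qve_moment S n $ x * (- t) ^ n) / CARD('n)) sums ((\<Sum>x\<in>UNIV. ?q x) / CARD('n))"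
    by (intro sums_divide sums_sum summable_sums axis(1))
  thus ?thesis unfolding eq by (simp add: sum_distrib_right)
qed

text \<open>The even moments of the density of states are the averaged \<^const>\<open>qve_moment\<close>, because both are the
coefficients of the same function on the imaginary axis. Their growth is controlled by
the convergence of the series at \<open>u = 1 / b\<^sup>2\<close>, where \<open>b\<close> is the claimed edge.\<close>

lemma msupp_dos_le:
  fixes S :: "real^'n^'n"
  assumes S: "\<forall>x y. 0 \<le> S $ x $ y" and "S \<noteq> 0" and root: "positive_root_phi S J w"
    and dos: "self_consistent_dos S \<rho>" and \<tau>: "\<tau> \<in> msupp \<rho>"
  shows "\<bar>\<tau>\<bar> \<le> 2 * (sqrt (max_row_sum_norm S) / w)"
proof -
  define s where "s = max_row_sum_norm S"
  define u where "u = (w / 2)\<^sup>2 / s"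
  define b where "b = 2 * (sqrt s / w)"
  have s: "0 < s" using max_row_sum_norm_pos[OF \<open>S \<noteq> 0\<close>] by (simp add: s_def)
  have w: "0 < w" using root by (auto simp: positive_root_phi_iff)
  have u: "0 < u" using s w by (simp add: u_def)
  have b: "0 \<le> b" "b\<^sup>2 * u = 1" using s w by (auto simp: b_def u_def power_mult_distrib power_divide)
  obtain m where prob: "prob_space \<rho>" and sets: "sets \<rho> = sets borel" and cpt: "compact (msupp \<rho>)"
    and sol: "qve_solution S m"
    and st: "\<And>z. Im z > 0 \<Longrightarrow>
       (\<Sum>x\<in>UNIV. m z $ x) / of_nat CARD('n) = (LINT \<tau>|\<rho>. 1 / (of_real \<tau> - z))"
    using dos by (auto simp: self_consistent_dos_def)
  obtain K where K: "\<And>x. x \<in> msupp \<rho> \<Longrightarrow> \<bar>x\<bar> \<le> K"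
    using compact_imp_bounded[OF cpt] by (auto simp: bounded_iff)
  have bd: "AE x in \<rho>. \<bar>x\<bar> \<le> K"
    using AE_msupp[OF sets] by eventually_elim (rule K)
  define A where "A n = (\<Sum>x\<in>UNIV. qve_moment S n $ x) / CARD('n)" for n
  \<comment> \<open>Below \<open>u\<close> the series of the \<open>A n\<close> represents the integral, below \<open>1 / (K\<^sup>2 + 1)\<close> the
    series of the moments does. The summand 1 covers \<open>K = 0\<close>.\<close>
  define \<epsilon> where "\<epsilon> = min u (1 / (K\<^sup>2 + 1))"
  have "0 < 1 / (K\<^sup>2 + 1)" by (simp add: add_nonneg_pos)
  hence "0 < \<epsilon>" using u by (simp add: \<epsilon>_def)
  have tK: "t * K\<^sup>2 < 1" if "0 < t" "t < \<epsilon>" for t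
  proof -
    have "t < 1 / (K\<^sup>2 + 1)" using that by (simp add: \<epsilon>_def)
    hence "t * (K\<^sup>2 + 1) < 1" by (subst (asm) pos_less_divide_eq) (auto intro: add_nonneg_pos)
    thus ?thesis using that by (simp add: distrib_left)
  qed
  have int: "integrable \<rho> (\<lambda>\<tau>. \<tau> ^ (2 * n))" for n
    by (rule even_moments_sums(1)[OF prob sets bd, where t = 0]) auto
  \<comment> \<open>The expansions are in powers of \<open>-t\<close>; the signs are moved into the coefficients.\<close>
  have "(LINT \<tau>|\<rho>. \<tau> ^ (2 * n)) * (-1) ^ n = A n * (-1) ^ n" for n
  proof (rule real_powser_eq_right_imp_coeffs_eq[OF \<open>0 < \<epsilon>\<close>,
        where f = "\<lambda>t. LINT \<tau>|\<rho>. 1 / (1 + t * \<tau>\<^sup>2)" and n = n])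
    fix t :: real assume t: "0 < t" "t < \<epsilon>"
    have pow: "(- t) ^ n = (-1) ^ n * t ^ n" for n by (simp flip: power_mult_distrib)
    show "(\<lambda>n. (LINT \<tau>|\<rho>. \<tau> ^ (2 * n)) * (-1) ^ n * t ^ n) sums (LINT \<tau>|\<rho>. 1 / (1 + t * \<tau>\<^sup>2))"
      using even_moments_sums(2)[OF prob sets bd _ tK[OF t]] t by (simp add: pow mult.assoc)
    show "(\<lambda>n. A n * (-1) ^ n * t ^ n) sums (LINT \<tau>|\<rho>. 1 / (1 + t * \<tau>\<^sup>2))"
      using dos_stieltjes_imaginary_axis[OF S \<open>S \<noteq> 0\<close> root prob sets sol st t(1)] t(2)
      by (simp add: pow mult.assoc A_def \<epsilon>_def u_def s_def)
  qed
  hence moment: "(LINT \<tau>|\<rho>. \<tau> ^ (2 * n)) = A n" for n by simp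
  have "A n \<le> 2 / w * b ^ (2 * n)" for n
  proof -
    have "qve_moment S n $ x * u ^ n \<le> 2 / w" for x
    proof -
      note sm = summable_qve_moment[OF S \<open>S \<noteq> 0\<close> root, of x, folded s_def, folded u_def]
      have "(\<Sum>k\<in>{n}. qve_moment S k $ x * u ^ k) \<le> (\<Sum>k. qve_moment S k $ x * u ^ k)"
        using u qve_moment_nonneg[OF S] by (intro sum_le_suminf sm(1)) auto
      thus ?thesis using sm(2) by simp
    qed
    hence "qve_moment S n $ x * u ^ n * b ^ (2 * n) \<le> 2 / w * b ^ (2 * n)" for x
      using b(1) by (intro mult_right_mono) auto
    moreover have "u ^ n * b ^ (2 * n) = 1"
    proof -
      have "u ^ n * b ^ (2 * n) = (b\<^sup>2 * u) ^ n"
        by (simp add: power_mult_distrib flip: power_mult)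
      thus ?thesis by (simp only: b(2) power_one)
    qed
    ultimately have "qve_moment S n $ x \<le> 2 / w * b ^ (2 * n)" for x
      by (metis mult.assoc mult.right_neutral)
    hence "(\<Sum>x\<in>UNIV. qve_moment S n $ x) \<le> of_nat CARD('n) * (2 / w * b ^ (2 * n))"
      by (intro sum_bounded_above) auto
    thus ?thesis by (simp add: A_def divide_le_eq mult.commute)
  qed
  hence "(LINT \<tau>|\<rho>. \<tau> ^ (2 * n)) \<le> 2 / w * b ^ (2 * n)" for n
    unfolding moment .
  hence "\<bar>\<tau>\<bar> \<le> b"
    by (rule msupp_bounded_by_even_moments[OF prob sets b(1) int _ \<tau>])
  thus ?thesis by (simp add: b_def s_def)
qed

section \<open>The bound on the support\<close>

theorem theorem1p1:
  fixes S :: "real^'n^'n" and \<rho> :: "real measure" and J :: enat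
  assumes "S \<noteq> 0"
    and "transpose S = S"
    and "\<forall>x y. S $ x $ y \<ge> 0"
    and "self_consistent_dos S \<rho>"
  shows "positive_root_phi S J (w_c S J) \<and>
         (\<forall>w. positive_root_phi S J w \<longrightarrow> w_c S J \<le> w) \<and>
         Sup (msupp \<rho>) \<le> 2 * (sqrt (max_row_sum_norm S) / w_c S J)"
proof -
  obtain w where w: "positive_root_phi S J w"
    using positive_root_phi_exists[OF assms(1)] by blast
  have wc: "w_c S J = w" by (rule w_c_eqI[OF w])
  have "prob_space \<rho>" "sets \<rho> = sets borel"
    using assms(4) by (auto simp: self_consistent_dos_def)
  hence "msupp \<rho> \<noteq> {}"
    using AE_msupp[of \<rho>] prob_space.AE_False[of \<rho>] by auto
  hence "Sup (msupp \<rho>) \<le> 2 * (sqrt (max_row_sum_norm S) / w)"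
    using msupp_dos_le[OF assms(3,1) w assms(4)] by (intro cSup_least) (auto dest: abs_le_D1)
  moreover have "\<forall>w'. positive_root_phi S J w' \<longrightarrow> w \<le> w'"
    using positive_root_phi_unique[OF w] by blast
  ultimately show ?thesis unfolding wc using w by blast
qed

end
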